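(* Let $G=(V,E)$ be a simple connected graph with $n\geq 2$ vertices $v_1,\dots,v_n$ and $m$ edges, and let $h(G)$, $\bar h(G)$ be its Cheeger and dual Cheeger constants. For $1\leq i\leq n$, \[\mathcal{LE}_G(v_i)\leq\frac{d_i}{2m}+\alpha\left(1-\frac{d_i}{2m}\right),\qquad\text{where }\alpha=\max\left\{\sqrt{1-h(G)^2},\,\sqrt{1-(1-\bar h(G))^2}\right\}.\]
   Context: $d_i$ is the degree of $v_i$. $A$ is the adjacency matrix, $D$ the diagonal degree matrix, $\mathcal{L}=I-D^{-1/2}AD^{-1/2}$ the normalized Laplacian; for a real symmetric $B$, $|B|:=(B^2)^{1/2}$; $\mathcal{LE}_G(v_i):=(|\mathcal{L}-I|)_{ii}$. For $U\subseteq V$, $\mathrm{vol}(U):=\sum_{v_k\in U}d_k$, and for disjoint $U,W\subseteq V$, $E(U,W)$ is the set of edges with one endpoint in $U$ and the other in $W$. Cheeger constant: $h(G):=\min_{U}\frac{|E(U,V\setminus U)|}{\min\{\mathrm{vol}(U),\mathrm{vol}(V\setminus U)\}}$ over nonempty proper subsets $U\subset V$. Dual Cheeger constant: $\bar h(G):=\max_{V_1,V_2}\frac{2|E(V_1,V_2)|}{\mathrm{vol}(V_1)+\mathrm{vol}(V_2)}$ over disjoint $V_1,V_2\subseteq V$ not both empty (so $V_1,V_2,V\setminus(V_1\cup V_2)$ partition $V$). *)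

theory Defs
  imports "HOL-Analysis.Analysis"
begin

text \<open>
  A finite simple graph has the elements of a finite type as its vertices and is given by its
  set of edges, each edge being a two-element set of vertices.
\<close>

definition simple_graph :: "'v::finite set set \<Rightarrow> bool" where
  "simple_graph E \<longleftrightarrow> (\<forall>e\<in>E. card e = 2)"

definition connected_graph :: "'v::finite set set \<Rightarrow> bool" where
  "connected_graph E \<longleftrightarrow> (\<forall>u v. (u, v) \<in> {(x, y). {x, y} \<in> E}\<^sup>*)"

definition vertex_degree :: "'v::finite set set \<Rightarrow> 'v \<Rightarrow> nat" where
  "vertex_degree E v = card {e \<in> E. v \<in> e}"

definition adjacency_matrix :: "'v::finite set set \<Rightarrow> real^'v^'v" where
  "adjacency_matrix E = (\<chi> i j. if {i, j} \<in> E then 1 else 0)"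

text \<open>
  The matrix \<open>D\<^sup>-\<^sup>1\<^sup>/\<^sup>2\<close> for the diagonal degree matrix \<open>D\<close>. An isolated vertex would get the
  entry 0; a connected graph with at least two vertices has none.
\<close>

definition degree_matrix_inv_sqrt :: "'v::finite set set \<Rightarrow> real^'v^'v" where
  "degree_matrix_inv_sqrt E = (\<chi> i j. if i = j then real (vertex_degree E i) powr (- 1 / 2) else 0)"

definition normalized_laplacian :: "'v::finite set set \<Rightarrow> real^'v^'v" where
  "normalized_laplacian E =
     mat 1 - degree_matrix_inv_sqrt E ** adjacency_matrix E ** degree_matrix_inv_sqrt E"

definition pos_semidef :: "real^'n^'n \<Rightarrow> bool" where
  "pos_semidef S \<longleftrightarrow> transpose S = S \<and> (\<forall>x. 0 \<le> x \<bullet> (S *v x))"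

text \<open>
  The square root \<open>P\<^sup>1\<^sup>/\<^sup>2\<close> of a positive semidefinite matrix \<open>P\<close> is its unique positive semidefinite
  square root. The value is unspecified for other \<open>P\<close>, but \<open>B ** B\<close> is positive
  semidefinite whenever \<open>B\<close> is symmetric.
\<close>

definition matrix_sqrt :: "real^'n^'n \<Rightarrow> real^'n^'n" where
  "matrix_sqrt P = (THE S. pos_semidef S \<and> S ** S = P)"

definition matrix_abs :: "real^'n^'n \<Rightarrow> real^'n^'n" where
  "matrix_abs B = matrix_sqrt (B ** B)"

definition laplacian_vertex_energy :: "'v::finite set set \<Rightarrow> 'v \<Rightarrow> real" where
  "laplacian_vertex_energy E v = matrix_abs (normalized_laplacian E - mat 1) $ v $ v"

definition vol :: "'v::finite set set \<Rightarrow> 'v set \<Rightarrow> nat" where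
  "vol E U = (\<Sum>v\<in>U. vertex_degree E v)"

definition edges_between :: "'v::finite set set \<Rightarrow> 'v set \<Rightarrow> 'v set \<Rightarrow> 'v set set" where
  "edges_between E U W = {e \<in> E. \<exists>u\<in>U. \<exists>w\<in>W. e = {u, w}}"

definition cheeger :: "'v::finite set set \<Rightarrow> real" where
  "cheeger E = Min {real (card (edges_between E U (- U))) / real (min (vol E U) (vol E (- U))) |U.
     U \<noteq> {} \<and> U \<noteq> UNIV}"

definition dual_cheeger :: "'v::finite set set \<Rightarrow> real" where
  "dual_cheeger E =
     Max {2 * real (card (edges_between E V\<^sub>1 V\<^sub>2)) / real (vol E V\<^sub>1 + vol E V\<^sub>2) |V\<^sub>1 V\<^sub>2.
       V\<^sub>1 \<inter> V\<^sub>2 = {} \<and> \<not> (V\<^sub>1 = {} \<and> V\<^sub>2 = {})}"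

end

theory Submission
  imports Defs
begin

text \<open>
  Put \<open>B = \<L> - I = - D\<^sup>-\<^sup>1\<^sup>/\<^sup>2 A D\<^sup>-\<^sup>1\<^sup>/\<^sup>2\<close>. The unit vector \<open>x\<close> with entries \<open>sqrt (d\<^sub>i / 2m)\<close> satisfies
  \<open>B x = - x\<close>, so diagonalising \<open>B\<close> on the orthogonal complement of \<open>x\<close> gives
  \<open>|B|\<^sub>i\<^sub>i \<le> x\<^sub>i\<^sup>2 + \<alpha> (1 - x\<^sub>i\<^sup>2)\<close> as soon as all eigenvalues of \<open>B\<close> there are at most \<open>\<alpha>\<close> in absolute
  value. This is what the Cheeger inequality (for the negative eigenvalues) and the dual Cheeger
  inequality of Bauer and Jost (for the positive ones) provide. Both follow from one argument: with
  \<open>N = \<Sum>\<^sub>v d\<^sub>v f(v)\<^sup>2\<close>, the sum over all edges \<open>uw\<close> of \<open>|\<phi>(u) \<mp> \<phi>(w)|\<close>, where \<open>\<phi> = f |f|\<close>, is bounded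
  below by \<open>c N\<close> by slicing \<open>\<phi>\<close> into level sets, and above by \<open>sqrt (N\<^sup>2 - Q\<^sup>2)\<close> by Cauchy--Schwarz, where
  the eigenvalue equation makes \<open>Q\<close> at least \<open>|\<lambda>| N\<close>.
\<close>

section \<open>Spectral theorem and absolute value of a symmetric matrix\<close>

text \<open>The minimality condition for a nonnegative quadratic form, without derivatives: moving
  from a zero \<open>u\<close> of the form along \<open>- g u\<close> would make it negative unless
  \<open>g u = 0\<close>. It serves to turn a maximiser of a Rayleigh quotient into an
  eigenvector.\<close>

lemma psd_form_zero_imp_zero:
  fixes g :: "'a::real_inner \<Rightarrow> 'a"
  assumes g: "linear g" and sym: "\<And>x y. x \<in> S \<Longrightarrow> y \<in> S \<Longrightarrow> g x \<bullet> y = x \<bullet> g y"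
    and S: "subspace S" and nonneg: "\<And>x. x \<in> S \<Longrightarrow> 0 \<le> x \<bullet> g x"
    and u: "u \<in> S" "g u \<in> S" "u \<bullet> g u = 0"
  shows "g u = 0"
proof -
  define w where "w = g u"
  define c e where "c = w \<bullet> w" and "e = w \<bullet> g w"
  \<comment> \<open>The optimal step would be \<open>c / e\<close>; adding 1 keeps the denominator
    positive when \<open>e = 0\<close>, and the form at \<open>u - t *\<^sub>R w\<close> becomes
    \<open>- (t * t * (e + 2))\<close>.\<close>
  define t where "t = c / (e + 1)"
  have wS: "w \<in> S" using u by (simp add: w_def)
  have e: "0 \<le> e" using nonneg wS by (simp add: e_def)
  have "u - t *\<^sub>R w \<in> S" using S u wS by (simp add: subspace_diff subspace_scale)
  then have "0 \<le> (u - t *\<^sub>R w) \<bullet> g (u - t *\<^sub>R w)" by (rule nonneg)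
  also have "\<dots> = u \<bullet> g u - t * (u \<bullet> g w) - t * (w \<bullet> g u) + t * t * (w \<bullet> g w)"
    by (simp add: linear_diff[OF g] linear_scale[OF g] inner_diff_left inner_diff_right algebra_simps)
  also have "u \<bullet> g w = c" using sym[OF u(1) wS] by (simp add: c_def w_def)
  also have "w \<bullet> g u = c" by (simp add: c_def w_def)
  finally have "0 \<le> t * (t * e - 2 * c)" using u by (simp add: e_def algebra_simps)
  moreover have c: "c = t * (e + 1)" using e by (simp add: t_def)
  ultimately have "0 \<le> t * (t * e - 2 * (t * (e + 1)))" by simp
  then have "0 \<le> - ((t * t) * (e + 2))" by (simp add: algebra_simps)
  then have "t * t * (e + 2) \<le> 0" by simp
  then have "t * t \<le> 0" using e by (simp add: mult_le_0_iff[of "t * t"])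
  then have "t = 0" by (auto simp: mult_le_0_iff)
  then have "c = 0" using c by simp
  then show ?thesis by (simp add: c_def w_def)
qed

text \<open>Induction on the dimension: a maximiser of \<open>x \<bullet> f x\<close> on the unit
  sphere of \<open>S\<close> is an eigenvector, and by symmetry its orthogonal complement in
  \<open>S\<close> is again invariant. A general \<open>S\<close> lets the theorem be applied later
  to a hyperplane.\<close>

lemma spectral_basis:
  fixes f :: "'a::euclidean_space \<Rightarrow> 'a"
  assumes f: "linear f" and sym: "\<And>x y. f x \<bullet> y = x \<bullet> f y"
    and "subspace S" and "f ` S \<subseteq> S"
  obtains B where "finite B" "B \<subseteq> S" "span B = S" "pairwise orthogonal B"
    "\<And>b. b \<in> B \<Longrightarrow> norm b = 1" "\<And>b. b \<in> B \<Longrightarrow> \<exists>r. f b = r *\<^sub>R b"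
proof -
  have "\<exists>B. finite B \<and> B \<subseteq> S \<and> span B = S \<and> pairwise orthogonal B \<and>
    (\<forall>b\<in>B. norm b = 1) \<and> (\<forall>b\<in>B. \<exists>r. f b = r *\<^sub>R b)"
    using \<open>subspace S\<close> \<open>f ` S \<subseteq> S\<close>
  proof (induction "dim S" arbitrary: S rule: less_induct)
    case less
    note S = \<open>subspace S\<close>
    show ?case
    proof (cases "S \<subseteq> {0}")
      case True
      then have "S = {0}" using subspace_0[OF S] by auto
      then show ?thesis by (intro exI[of _ "{}"]) auto
    next
      case False
      then obtain z where z: "z \<in> S" "z \<noteq> 0" by auto
      define K where "K = S \<inter> sphere 0 1"
      have "z /\<^sub>R norm z \<in> K" using z S by (simp add: K_def subspace_scale)
      moreover have "compact K" unfolding K_def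
        by (rule closed_Int_compact) (simp_all add: closed_subspace S)
      moreover have "continuous_on K (\<lambda>x. x \<bullet> f x)"
        using f by (intro continuous_on_inner continuous_on_id linear_continuous_on) (simp add: linear_conv_bounded_linear)
      ultimately obtain u where uK: "u \<in> K" and max: "\<And>x. x \<in> K \<Longrightarrow> x \<bullet> f x \<le> u \<bullet> f u"
        using continuous_attains_sup[of K "\<lambda>x. x \<bullet> f x"] by blast
      have u: "u \<in> S" "norm u = 1" "u \<bullet> u = 1" using uK by (auto simp: K_def dot_square_norm)
      define l where "l = u \<bullet> f u"
      \<comment> \<open>As \<open>l\<close> is the maximum of the Rayleigh quotient on
        \<open>S\<close>, the form of \<open>l - f\<close> is nonnegative there and vanishes at
        \<open>u\<close>.\<close>
      have "l *\<^sub>R u - f u = 0"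
      proof (rule psd_form_zero_imp_zero[where g = "\<lambda>x. l *\<^sub>R x - f x" and S = S])
        show "linear (\<lambda>x. l *\<^sub>R x - f x)"
          by (rule linearI) (simp_all add: linear_add[OF f] linear_scale[OF f] algebra_simps)
        show "0 \<le> x \<bullet> (l *\<^sub>R x - f x)" if "x \<in> S" for x
        proof (cases "x = 0")
          case False
          then have "x /\<^sub>R norm x \<in> K" using that S by (simp add: K_def subspace_scale)
          from max[OF this] have "(x \<bullet> f x) / (norm x)\<^sup>2 \<le> l"
            by (simp add: linear_scale[OF f] l_def power2_eq_square divide_inverse ac_simps)
          then have "x \<bullet> f x \<le> l * (norm x)\<^sup>2" using False by (simp add: pos_divide_le_eq)
          then show ?thesis by (simp add: inner_diff_right dot_square_norm)
        qed simp
        show "(l *\<^sub>R x - f x) \<bullet> y = x \<bullet> (l *\<^sub>R y - f y)" for x y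
          by (simp add: inner_diff_left inner_diff_right sym)
        show "l *\<^sub>R u - f u \<in> S" using u S less.prems by (auto intro!: subspace_diff subspace_scale)
        show "u \<bullet> (l *\<^sub>R u - f u) = 0" using u by (simp add: inner_diff_right l_def)
      qed (use S u in auto)
      then have fu: "f u = l *\<^sub>R u" by simp
      define T where "T = S \<inter> {x. u \<bullet> x = 0}"
      have T: "subspace T" unfolding T_def by (intro subspace_inter S subspace_hyperplane)
      have "u \<notin> T" using u by (simp add: T_def)
      moreover have "T \<subseteq> S" by (simp add: T_def)
      ultimately have "T \<subset> S" using u(1) by auto
      then have "dim T < dim S" using S T by (intro dim_psubset) (simp add: span_eq_iff[THEN iffD2])
      moreover have "f ` T \<subseteq> T"
      proof clarify
        fix x assume "x \<in> T"
        then have "u \<bullet> f x = 0" "x \<in> S" using sym[of u x] by (simp_all add: T_def fu)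
        then show "f x \<in> T" using less.prems by (auto simp: T_def)
      qed
      ultimately have "\<exists>B. finite B \<and> B \<subseteq> T \<and> span B = T \<and> pairwise orthogonal B \<and>
        (\<forall>b\<in>B. norm b = 1) \<and> (\<forall>b\<in>B. \<exists>r. f b = r *\<^sub>R b)"
        using T by (intro less.hyps)
      then obtain B where B: "finite B" "B \<subseteq> T" "span B = T" "pairwise orthogonal B"
        "\<forall>b\<in>B. norm b = 1" "\<forall>b\<in>B. \<exists>r. f b = r *\<^sub>R b"
        by (elim exE conjE)
      have "span (insert u B) = S"
      proof
        show "span (insert u B) \<subseteq> S" using S u B(2) by (intro span_minimal) (auto simp: T_def)
        show "S \<subseteq> span (insert u B)"
        proof
          fix x assume "x \<in> S"
          then have "x - (u \<bullet> x) *\<^sub>R u \<in> span B" unfolding B(3)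
            using S u by (simp add: T_def inner_diff_right subspace_diff subspace_scale)
          then show "x \<in> span (insert u B)" by (auto simp: span_insert)
        qed
      qed
      moreover have "pairwise orthogonal (insert u B)"
        using B(2,4) by (auto simp: pairwise_insert orthogonal_def T_def inner_commute)
      ultimately show ?thesis
        using B u fu by (intro exI[of _ "insert u B"]) (auto simp: T_def)
    qed
  qed
  then obtain B where "finite B \<and> B \<subseteq> S \<and> span B = S \<and> pairwise orthogonal B \<and>
    (\<forall>b\<in>B. norm b = 1) \<and> (\<forall>b\<in>B. \<exists>r. f b = r *\<^sub>R b)" ..
  then show ?thesis by (intro that[of B]) simp_all
qed

section \<open>Square roots and absolute values of symmetric matrices\<close>

lemma matrix_inner_symmetric:
  fixes B :: "real^'n^'n"
  assumes "transpose B = B"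
  shows "(B *v x) \<bullet> y = x \<bullet> (B *v y)"
  by (metis assms dot_lmul_matrix transpose_matrix_vector)

text \<open>Factor the hypothesis as \<open>(S + r) (S - r) x = 0\<close>: then
  \<open>w = (S - r) x\<close> satisfies \<open>S w = - r w\<close>, which positive semidefiniteness
  allows only for \<open>w = 0\<close> if \<open>r > 0\<close>. If \<open>r = 0\<close>, the squared
  norm of \<open>w\<close> is \<open>x \<bullet> (S *v (S *v x)) = 0\<close>.\<close>

lemma pos_semidef_sqrt_eigenvector:
  fixes S :: "real^'n^'n"
  assumes S: "pos_semidef S" and eq: "S *v (S *v x) = r\<^sup>2 *\<^sub>R x" and r: "0 \<le> r"
  shows "S *v x = r *\<^sub>R x"
proof -
  have sym: "(S *v a) \<bullet> b = a \<bullet> (S *v b)" for a b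
    using S by (intro matrix_inner_symmetric) (simp add: pos_semidef_def)
  define w where "w = S *v x - r *\<^sub>R x"
  have Sw: "S *v w = - r *\<^sub>R w"
    using eq by (simp add: w_def matrix_vector_mult_diff_distrib matrix_vector_mult_scaleR algebra_simps power2_eq_square)
  have "0 \<le> w \<bullet> (S *v w)" using S by (simp add: pos_semidef_def)
  then have le: "r * (w \<bullet> w) \<le> 0" by (simp add: Sw)
  have "w = 0"
  proof (cases "r = 0")
    case True
    then have "w \<bullet> w = x \<bullet> (S *v (S *v x))" by (simp add: w_def sym)
    then show ?thesis using eq True by simp
  next
    case False
    then have "w \<bullet> w \<le> 0" using le r by (simp add: mult_le_0_iff)
    then show ?thesis by (metis inner_eq_zero_iff inner_ge_zero order_antisym)
  qed
  then show ?thesis by (simp add: w_def)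
qed

lemma symmetric_matrix_eigenbasis:
  fixes B :: "real^'n^'n"
  assumes "transpose B = B" "subspace S" "\<And>x. x \<in> S \<Longrightarrow> B *v x \<in> S"
  obtains C r where "finite C" "C \<subseteq> S" "\<And>b. b \<in> C \<Longrightarrow> B *v b = r b *\<^sub>R b"
    "\<And>b c. b \<in> C \<Longrightarrow> c \<in> C \<Longrightarrow> b \<bullet> c = (if b = c then 1 else 0)"
    "\<And>x. x \<in> S \<Longrightarrow> (\<Sum>b\<in>C. (x \<bullet> b) *\<^sub>R b) = x"
proof -
  obtain C where C: "finite C" "C \<subseteq> S" "span C = S" "pairwise orthogonal C"
    "\<And>b. b \<in> C \<Longrightarrow> norm b = 1" "\<And>b. b \<in> C \<Longrightarrow> \<exists>r. B *v b = r *\<^sub>R b"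
  proof (rule spectral_basis[of "(*v) B" S])
    show "(*v) B ` S \<subseteq> S" using assms(3) by auto
    show "(B *v x) \<bullet> y = x \<bullet> (B *v y)" for x y by (rule matrix_inner_symmetric[OF assms(1)])
  qed (use assms(2) in simp_all)
  from C(6) obtain r where "\<And>b. b \<in> C \<Longrightarrow> B *v b = r b *\<^sub>R b" by metis
  moreover have "b \<bullet> c = (if b = c then 1 else 0)" if "b \<in> C" "c \<in> C" for b c
    using C(4,5) that by (auto simp: pairwise_def orthogonal_def dot_square_norm)
  moreover have "(\<Sum>b\<in>C. (x \<bullet> b) *\<^sub>R b) = x" if "x \<in> S" for x
    using C that by (intro orthonormal_basis_expand) auto
  ultimately show ?thesis using C(1,2) by (intro that[of C r])
qed

text \<open>Justifies the definite description behind \<open>matrix_abs\<close>. A root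
  \<open>S\<close> exists by replacing each eigenvalue in an eigenbasis of \<open>B\<close> by its
  absolute value; any other positive semidefinite root acts in the same way on each basis vector,
  hence equals \<open>S\<close>.\<close>

lemma matrix_abs_symmetric:
  fixes B :: "real^'n^'n"
  assumes B: "transpose B = B"
  shows "pos_semidef (matrix_abs B)" "matrix_abs B ** matrix_abs B = B ** B"
proof -
  obtain C r where C: "finite C" "\<And>b. b \<in> C \<Longrightarrow> B *v b = r b *\<^sub>R b"
    "\<And>b c. b \<in> C \<Longrightarrow> c \<in> C \<Longrightarrow> b \<bullet> c = (if b = c then 1 else 0)"
    "\<And>x. (\<Sum>b\<in>C. (x \<bullet> b) *\<^sub>R b) = x"
    by (rule symmetric_matrix_eigenbasis[OF B subspace_UNIV UNIV_I]) (simp only: UNIV_I)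
  define f where "f x = (\<Sum>b\<in>C. (\<bar>r b\<bar> * (x \<bullet> b)) *\<^sub>R b)" for x :: "real^'n"
  have f: "linear f" unfolding f_def
    by (rule linearI) (simp_all add: inner_add_left scaleR_sum_right algebra_simps sum.distrib)
  define S where "S = matrix f"
  have Sv: "S *v x = f x" for x unfolding S_def by (simp add: matrix_works f)
  have Sb: "S *v b = \<bar>r b\<bar> *\<^sub>R b" if "b \<in> C" for b
  proof -
    have "S *v b = (\<Sum>c\<in>C. if b = c then \<bar>r b\<bar> *\<^sub>R b else 0)"
      unfolding Sv f_def using that C by (intro sum.cong) auto
    then show ?thesis using C(1) that by simp
  qed
  have eqI: "S1 = S2" if "\<And>b. b \<in> C \<Longrightarrow> S1 *v b = S2 *v b" for S1 S2 :: "real^'n^'n"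
    unfolding matrix_eq
  proof
    fix x
    have "S1 *v (\<Sum>b\<in>C. (x \<bullet> b) *\<^sub>R b) = S2 *v (\<Sum>b\<in>C. (x \<bullet> b) *\<^sub>R b)"
      using that by (simp add: linear_sum[OF matrix_vector_mul_linear] matrix_vector_mult_scaleR)
    then show "S1 *v x = S2 *v x" by (simp add: C(4))
  qed
  have inner: "y \<bullet> (S *v x) = (\<Sum>b\<in>C. \<bar>r b\<bar> * (x \<bullet> b) * (y \<bullet> b))" for x y
    by (simp add: Sv f_def inner_sum_right)
  have "transpose S = S"
  proof -
    have "(transpose S *v x) \<bullet> y = (S *v x) \<bullet> y" for x y
    proof -
      have "(transpose S *v x) \<bullet> y = x \<bullet> (S *v y)" by (simp add: dot_lmul_matrix)
      also have "\<dots> = y \<bullet> (S *v x)" unfolding inner by (simp add: ac_simps)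
      finally show ?thesis by (simp only: inner_commute)
    qed
    then have "transpose S *v x = S *v x" for x
      unfolding vector_eq_rdot[of "transpose S *v x", symmetric] by blast
    then show ?thesis unfolding matrix_eq by blast
  qed
  moreover have "0 \<le> x \<bullet> (S *v x)" for x
    unfolding inner by (intro sum_nonneg) (simp add: mult.assoc)
  ultimately have psd: "pos_semidef S" by (simp add: pos_semidef_def)
  have sq: "S ** S = B ** B"
    by (rule eqI) (simp add: Sb C(2) matrix_vector_mult_scaleR flip: matrix_vector_mul_assoc)
  have "matrix_abs B = S" unfolding matrix_abs_def matrix_sqrt_def
  proof (rule the_equality)
    fix T assume T: "pos_semidef T \<and> T ** T = B ** B"
    show "T = S"
    proof (rule eqI)
      fix b assume b: "b \<in> C"
      have "T *v (T *v b) = (B ** B) *v b" using T by (simp add: matrix_vector_mul_assoc)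
      also have "\<dots> = \<bar>r b\<bar>\<^sup>2 *\<^sub>R b"
        using b by (simp add: C(2) matrix_vector_mult_scaleR power2_eq_square flip: matrix_vector_mul_assoc)
      finally have "T *v b = \<bar>r b\<bar> *\<^sub>R b" using T by (intro pos_semidef_sqrt_eigenvector) auto
      then show "T *v b = S *v b" using b by (simp add: Sb)
    qed
  qed (use psd sq in auto)
  then show "pos_semidef (matrix_abs B)" "matrix_abs B ** matrix_abs B = B ** B"
    using psd sq by auto
qed

lemma matrix_abs_eigenvector:
  fixes B :: "real^'n^'n"
  assumes "transpose B = B" "B *v x = r *\<^sub>R x"
  shows "matrix_abs B *v x = \<bar>r\<bar> *\<^sub>R x"
proof (rule pos_semidef_sqrt_eigenvector)
  show "matrix_abs B *v (matrix_abs B *v x) = \<bar>r\<bar>\<^sup>2 *\<^sub>R x"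
    using matrix_abs_symmetric(2)[OF assms(1)] assms(2)
    by (simp add: matrix_vector_mul_assoc)
      (simp add: matrix_vector_mult_scaleR power2_eq_square flip: matrix_vector_mul_assoc)
qed (simp_all add: matrix_abs_symmetric assms)

text \<open>Off the line spanned by \<open>u\<close>, the matrix \<open>|B|\<close> is at most \<open>a\<close>; splitting the basis
  vector into its component along \<open>u\<close> and the rest bounds the diagonal entry.\<close>

lemma matrix_abs_diag_le:
  fixes B :: "real^'n^'n"
  assumes B: "transpose B = B" and u: "B *v u = l *\<^sub>R u" "norm u = 1"
    and le: "\<And>r y. y \<noteq> 0 \<Longrightarrow> u \<bullet> y = 0 \<Longrightarrow> B *v y = r *\<^sub>R y \<Longrightarrow> \<bar>r\<bar> \<le> a"
  shows "matrix_abs B $ i $ i \<le> \<bar>l\<bar> * (u $ i)\<^sup>2 + a * (1 - (u $ i)\<^sup>2)"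
proof -
  define A where "A = matrix_abs B"
  have symA: "(A *v x) \<bullet> y = x \<bullet> (A *v y)" for x y
    using matrix_abs_symmetric(1)[OF B]
    by (intro matrix_inner_symmetric) (simp add: A_def pos_semidef_def)
  have Au: "A *v u = \<bar>l\<bar> *\<^sub>R u" using matrix_abs_eigenvector[OF B u(1)] by (simp add: A_def)
  define S where "S = {y. u \<bullet> y = 0}"
  have uu: "u \<bullet> u = 1" using u(2) by (simp add: dot_square_norm)
  have subS: "subspace S" unfolding S_def by (rule subspace_hyperplane)
  have "B *v y \<in> S" if "y \<in> S" for y
    using matrix_inner_symmetric[OF B, of u y] that by (simp add: S_def u)
  note S = subS this
  obtain C r where C: "finite C" "C \<subseteq> S" "\<And>b. b \<in> C \<Longrightarrow> B *v b = r b *\<^sub>R b"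
    "\<And>b c. b \<in> C \<Longrightarrow> c \<in> C \<Longrightarrow> b \<bullet> c = (if b = c then 1 else 0)"
    "\<And>x. x \<in> S \<Longrightarrow> (\<Sum>b\<in>C. (x \<bullet> b) *\<^sub>R b) = x"
    using symmetric_matrix_eigenbasis[OF B S] by blast
  \<comment> \<open>The projection of the basis vector onto the complement of \<open>u\<close>; its
    squared norm is \<open>1 - (u $ i)\<^sup>2\<close>. Cross terms vanish later because
    \<open>A *v u\<close> is a multiple of \<open>u\<close>.\<close>
  define y where "y = axis i 1 - (u $ i) *\<^sub>R u"
  have uy: "u \<bullet> y = 0" by (simp add: y_def inner_diff_right inner_axis uu)
  have yC: "y = (\<Sum>b\<in>C. (y \<bullet> b) *\<^sub>R b)" using C(5)[of y] uy by (simp add: S_def)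
  have Ay: "A *v y = (\<Sum>b\<in>C. (\<bar>r b\<bar> * (y \<bullet> b)) *\<^sub>R b)"
  proof -
    have "A *v y = A *v (\<Sum>b\<in>C. (y \<bullet> b) *\<^sub>R b)" by (rule arg_cong[OF yC])
    also have "\<dots> = (\<Sum>b\<in>C. (y \<bullet> b) *\<^sub>R (A *v b))"
      by (simp add: linear_sum[OF matrix_vector_mul_linear] matrix_vector_mult_scaleR)
    also have "\<dots> = (\<Sum>b\<in>C. (\<bar>r b\<bar> * (y \<bullet> b)) *\<^sub>R b)"
      using matrix_abs_eigenvector[OF B C(3)] by (intro sum.cong) (simp_all add: A_def mult.commute)
    finally show ?thesis .
  qed
  have "y \<bullet> (A *v y) = (\<Sum>b\<in>C. \<bar>r b\<bar> * (y \<bullet> b)\<^sup>2)"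
    unfolding Ay by (simp add: inner_sum_right power2_eq_square mult.assoc)
  also have "\<dots> \<le> (\<Sum>b\<in>C. a * (y \<bullet> b)\<^sup>2)"
  proof (intro sum_mono mult_right_mono)
    fix b assume b: "b \<in> C"
    then have "b \<noteq> 0" "u \<bullet> b = 0" using C(4)[OF b b] C(2) by (auto simp: S_def)
    then show "\<bar>r b\<bar> \<le> a" by (rule le[OF _ _ C(3)[OF b]])
  qed simp
  also have "\<dots> = a * (y \<bullet> (\<Sum>b\<in>C. (y \<bullet> b) *\<^sub>R b))"
    by (simp add: inner_sum_right sum_distrib_left power2_eq_square)
  also have "\<dots> = a * (y \<bullet> y)" by (simp only: yC[symmetric])
  also have "y \<bullet> y = 1 - (u $ i)\<^sup>2"
    by (simp add: y_def inner_diff_left inner_diff_right inner_axis inner_axis' uu power2_eq_square)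
  finally have le: "y \<bullet> (A *v y) \<le> a * (1 - (u $ i)\<^sup>2)" .
  have ax: "axis i 1 = (u $ i) *\<^sub>R u + y" by (simp add: y_def)
  have "A $ i $ i = axis i 1 \<bullet> (A *v axis i 1)"
    by (simp add: inner_axis' matrix_vector_mult_basis column_def)
  also have "\<dots> = \<bar>l\<bar> * (u $ i)\<^sup>2 + y \<bullet> (A *v y)"
    using symA[of u y] uy unfolding ax
    by (simp add: matrix_vector_right_distrib matrix_vector_mult_scaleR Au inner_add_left inner_add_right
        uu power2_eq_square inner_commute[of y u])
  finally show ?thesis using le by (simp add: A_def)
qed

section \<open>A Cheeger inequality for weighted graphs\<close>

text \<open>A discrete substitute for integrating over level sets: take \<open>t\<close> to be the
  least nonzero absolute value of \<open>\<phi>\<close> and peel off the layer of height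
  \<open>t\<close>. No sign flips, and the support shrinks because the minimisers become
  zero.\<close>

lemma layer_induct [case_names zero layer]:
  fixes \<phi> :: "'v::finite \<Rightarrow> real"
  assumes zero: "P (\<lambda>_. 0)"
    and layer: "\<And>\<phi> \<psi> t. t > 0 \<Longrightarrow> (\<And>v. \<phi> v = t * sgn (\<phi> v) + \<psi> v) \<Longrightarrow>
      (\<And>v. \<psi> v = 0 \<or> sgn (\<psi> v) = sgn (\<phi> v)) \<Longrightarrow> P \<psi> \<Longrightarrow> P \<phi>"
  shows "P \<phi>"
proof (induction "card {v. \<phi> v \<noteq> 0}" arbitrary: \<phi> rule: less_induct)
  case less
  show ?case
  proof (cases "{v. \<phi> v \<noteq> 0} = {}")
    case True
    then have "\<phi> = (\<lambda>_. 0)" by auto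
    then show ?thesis using zero by simp
  next
    case False
    define t where "t = Min ((\<lambda>v. \<bar>\<phi> v\<bar>) ` {v. \<phi> v \<noteq> 0})"
    have "t \<in> (\<lambda>v. \<bar>\<phi> v\<bar>) ` {v. \<phi> v \<noteq> 0}"
      unfolding t_def using False by (intro Min_in) auto
    then obtain z where z: "\<phi> z \<noteq> 0" "t = \<bar>\<phi> z\<bar>" by auto
    have t: "t \<le> \<bar>\<phi> v\<bar>" if "\<phi> v \<noteq> 0" for v
      unfolding t_def using that by (intro Min_le) auto
    define \<psi> where "\<psi> v = \<phi> v - t * sgn (\<phi> v)" for v
    have "\<psi> z = 0" using z by (simp add: \<psi>_def abs_mult_sgn)
    then have "{v. \<psi> v \<noteq> 0} \<subset> {v. \<phi> v \<noteq> 0}" using z by (auto simp: \<psi>_def)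
    then have IH: "P \<psi>" by (intro less psubset_card_mono) auto
    show ?thesis
    proof (rule layer[OF _ _ _ IH])
      show "\<psi> v = 0 \<or> sgn (\<psi> v) = sgn (\<phi> v)" for v
        using t[of v] by (cases "\<phi> v = 0") (auto simp: \<psi>_def sgn_if)
    qed (use z in \<open>auto simp: \<psi>_def\<close>)
  qed
qed

text \<open>Absolute values add because \<open>p + s * q\<close> and \<open>a + s * b\<close> never
  have opposite signs; where \<open>p\<close> and \<open>s * q\<close> cancel, the first is simply
  zero.\<close>

lemma abs_layer_add:
  fixes t s p q a b :: real
  assumes "t > 0" "s = 1 \<or> s = -1"
    "p = 1 \<and> a \<ge> 0 \<or> p = -1 \<and> a \<le> 0 \<or> p = 0 \<and> a = 0"
    "q = 1 \<and> b \<ge> 0 \<or> q = -1 \<and> b \<le> 0 \<or> q = 0 \<and> b = 0"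
  shows "\<bar>t * p + a + s * (t * q + b)\<bar> = t * \<bar>p + s * q\<bar> + \<bar>a + s * b\<bar>"
  using assms by (elim disjE conjE) simp_all

text \<open>A discrete co-area inequality: \<open>s = - 1\<close> is used with the Cheeger constant and \<open>s = 1\<close>
  with its dual, where the layer \<open>y\<close> encodes the pair \<open>V\<^sub>1 = {y = 1}\<close>, \<open>V\<^sub>2 = {y = -1}\<close>.\<close>

lemma layer_inequality:
  fixes a :: "'v::finite \<Rightarrow> 'v \<Rightarrow> real" and d :: "'v \<Rightarrow> real"
  assumes s: "s = 1 \<or> s = -1"
    and layer: "\<And>y. (\<And>v. y v = 0 \<or> y v = sgn (\<phi> v)) \<Longrightarrow>
      c * (\<Sum>v\<in>UNIV. d v * \<bar>y v\<bar>) \<le> (\<Sum>u\<in>UNIV. \<Sum>w\<in>UNIV. a u w * \<bar>y u + s * y w\<bar>)"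
  shows "c * (\<Sum>v\<in>UNIV. d v * \<bar>\<phi> v\<bar>) \<le> (\<Sum>u\<in>UNIV. \<Sum>w\<in>UNIV. a u w * \<bar>\<phi> u + s * \<phi> w\<bar>)"
  using layer
proof (induction \<phi> rule: layer_induct)
  case (layer \<phi> \<psi> t)
  define y where "y v = sgn (\<phi> v)" for v
  have \<phi>: "\<phi> v = t * y v + \<psi> v" for v using layer(2) by (simp add: y_def)
  have y: "y v = 1 \<and> \<psi> v \<ge> 0 \<or> y v = -1 \<and> \<psi> v \<le> 0 \<or> y v = 0 \<and> \<psi> v = 0" for v
    using layer(3)[of v] by (auto simp: y_def sgn_if split: if_splits)
  have abs1: "\<bar>\<phi> v\<bar> = t * \<bar>y v\<bar> + \<bar>\<psi> v\<bar>" for v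
    using y[of v] \<open>t > 0\<close> by (subst \<phi>) (elim disjE conjE; simp)
  have abs2: "\<bar>\<phi> u + s * \<phi> w\<bar> = t * \<bar>y u + s * y w\<bar> + \<bar>\<psi> u + s * \<psi> w\<bar>" for u w
    unfolding \<phi>[of u] \<phi>[of w] using \<open>t > 0\<close> s y[of u] y[of w] by (rule abs_layer_add)
  have "c * (\<Sum>v\<in>UNIV. d v * \<bar>y v\<bar>) \<le> (\<Sum>u\<in>UNIV. \<Sum>w\<in>UNIV. a u w * \<bar>y u + s * y w\<bar>)"
    by (rule layer.prems) (simp add: y_def)
  then have "t * (c * (\<Sum>v\<in>UNIV. d v * \<bar>y v\<bar>)) \<le> t * (\<Sum>u\<in>UNIV. \<Sum>w\<in>UNIV. a u w * \<bar>y u + s * y w\<bar>)"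
    using \<open>t > 0\<close> by simp
  moreover have "c * (\<Sum>v\<in>UNIV. d v * \<bar>\<psi> v\<bar>) \<le> (\<Sum>u\<in>UNIV. \<Sum>w\<in>UNIV. a u w * \<bar>\<psi> u + s * \<psi> w\<bar>)"
  proof (rule layer.IH)
    \<comment> \<open>A layer of \<open>\<psi>\<close> is also a layer of \<open>\<phi>\<close>,
      since \<open>sgn (\<psi> v)\<close> is zero or \<open>sgn (\<phi> v)\<close>; this hands the
      hypothesis down.\<close>
    fix y' assume "\<And>v. y' v = 0 \<or> y' v = sgn (\<psi> v)"
    then have "y' v = 0 \<or> y' v = sgn (\<phi> v)" for v using layer(3)[of v] by (metis sgn_0)
    then show "c * (\<Sum>v\<in>UNIV. d v * \<bar>y' v\<bar>) \<le> (\<Sum>u\<in>UNIV. \<Sum>w\<in>UNIV. a u w * \<bar>y' u + s * y' w\<bar>)"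
      by (rule layer.prems)
  qed
  ultimately show ?case
    unfolding abs1 abs2 by (simp add: distrib_left sum.distrib sum_distrib_left mult.left_commute)
qed simp

text \<open>A pair that is not \<open>good\<close> is treated as if its edge were replaced by two edges from its ends to
  an extra vertex where \<open>g\<close> vanishes. This keeps the bound in terms of \<open>Q\<close> sharp when the
  eigenfunction of the dual Cheeger inequality has the same sign at both ends of an edge.\<close>

lemma weighted_cut_Cauchy_Schwarz:
  fixes a :: "'v::finite \<Rightarrow> 'v \<Rightarrow> real" and g :: "'v \<Rightarrow> real" and good :: "'v \<Rightarrow> 'v \<Rightarrow> bool"
  assumes sym: "\<And>u w. a u w = a w u" and nonneg: "\<And>u w. 0 \<le> a u w"
  defines "N \<equiv> (\<Sum>u\<in>UNIV. (\<Sum>w\<in>UNIV. a u w) * (g u)\<^sup>2)"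
    and "Q \<equiv> (\<Sum>u\<in>UNIV. \<Sum>w\<in>UNIV. if good u w then a u w * (g u * g w) else 0)"
  shows "(\<Sum>u\<in>UNIV. \<Sum>w\<in>UNIV. a u w * (if good u w then \<bar>(g u)\<^sup>2 - (g w)\<^sup>2\<bar> else (g u)\<^sup>2 + (g w)\<^sup>2))\<^sup>2
    \<le> 4 * (N\<^sup>2 - Q\<^sup>2)"
proof -
  \<comment> \<open>Chosen so that \<open>p * q\<close> is the summand, while the squares sum to
    \<open>2 * N - 2 * Q\<close> and \<open>2 * N + 2 * Q\<close>. On a pair that is not good the
    two factors coincide and contribute nothing to \<open>Q\<close>.\<close>
  define p q where "p z = (case z of (u, w) \<Rightarrow> sqrt (a u w) * (if good u w then \<bar>g u - g w\<bar> else sqrt ((g u)\<^sup>2 + (g w)\<^sup>2)))"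
    and "q z = (case z of (u, w) \<Rightarrow> sqrt (a u w) * (if good u w then \<bar>g u + g w\<bar> else sqrt ((g u)\<^sup>2 + (g w)\<^sup>2)))" for z
  have N1: "N = (\<Sum>u\<in>UNIV. \<Sum>w\<in>UNIV. a u w * (g u)\<^sup>2)" by (simp add: N_def sum_distrib_right)
  have N2: "N = (\<Sum>u\<in>UNIV. \<Sum>w\<in>UNIV. a u w * (g w)\<^sup>2)"
    unfolding N1 by (subst sum.swap) (simp add: sym)
  have pq: "p (u, w) * q (u, w) = a u w * (if good u w then \<bar>(g u)\<^sup>2 - (g w)\<^sup>2\<bar> else (g u)\<^sup>2 + (g w)\<^sup>2)" for u w
  proof -
    have sqrt2: "sqrt (a u w) * X * (sqrt (a u w) * Y) = a u w * (X * Y)" for X Y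
    proof -
      have "sqrt (a u w) * X * (sqrt (a u w) * Y) = (sqrt (a u w) * sqrt (a u w)) * (X * Y)"
        by (simp only: ac_simps)
      then show ?thesis using nonneg[of u w] by simp
    qed
    have "p (u, w) * q (u, w) = a u w * (if good u w then \<bar>g u - g w\<bar> * \<bar>g u + g w\<bar> else (g u)\<^sup>2 + (g w)\<^sup>2)"
      unfolding p_def q_def prod.case sqrt2 by simp
    also have "\<bar>g u - g w\<bar> * \<bar>g u + g w\<bar> = \<bar>(g u)\<^sup>2 - (g w)\<^sup>2\<bar>"
      unfolding abs_mult[symmetric] by (simp add: power2_eq_square algebra_simps)
    finally show ?thesis .
  qed
  have p2: "(p (u, w))\<^sup>2 = a u w * (g u)\<^sup>2 + a u w * (g w)\<^sup>2 - 2 * (if good u w then a u w * (g u * g w) else 0)" for u w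
    using nonneg by (simp add: p_def power_mult_distrib power2_diff algebra_simps)
  have q2: "(q (u, w))\<^sup>2 = a u w * (g u)\<^sup>2 + a u w * (g w)\<^sup>2 + 2 * (if good u w then a u w * (g u * g w) else 0)" for u w
    using nonneg by (simp add: q_def power_mult_distrib power2_sum algebra_simps)
  have pairs: "(\<Sum>z\<in>UNIV. F z) = (\<Sum>u\<in>UNIV. \<Sum>w\<in>UNIV. F (u, w))" for F :: "'v \<times> 'v \<Rightarrow> real"
    by (simp add: sum.cartesian_product)
  have "(\<Sum>z\<in>UNIV. p z * q z)\<^sup>2 \<le> (\<Sum>z\<in>UNIV. (p z)\<^sup>2) * (\<Sum>z\<in>UNIV. (q z)\<^sup>2)"
    by (rule Cauchy_Schwarz_ineq_sum)
  also have "(\<Sum>z\<in>UNIV. (p z)\<^sup>2) = N + N - 2 * Q"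
    unfolding pairs p2 sum.distrib sum_subtractf sum_distrib_left[symmetric] Q_def by (simp only: N1[symmetric] N2[symmetric])
  also have "(\<Sum>z\<in>UNIV. (q z)\<^sup>2) = N + N + 2 * Q"
    unfolding pairs q2 sum.distrib sum_distrib_left[symmetric] Q_def by (simp only: N1[symmetric] N2[symmetric])
  also have "(N + N - 2 * Q) * (N + N + 2 * Q) = 4 * (N\<^sup>2 - Q\<^sup>2)"
    by (simp add: power2_eq_square algebra_simps)
  finally show ?thesis unfolding pairs pq .
qed

text \<open>The layers of \<open>\<phi> v = g v * \<bar>g v\<bar>\<close> give
  \<open>2 * c * N \<le> T\<close>, Cauchy--Schwarz gives
  \<open>T\<^sup>2 \<le> 4 * (N\<^sup>2 - Q\<^sup>2)\<close>, and \<open>rayleigh\<close> says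
  \<open>r * N \<le> Q\<close>; divide by \<open>4 * N\<^sup>2\<close>. The factor 2 arises because
  the double sum meets each pair in both orders.\<close>

lemma weighted_cheeger_inequality:
  fixes a :: "'v::finite \<Rightarrow> 'v \<Rightarrow> real" and g :: "'v \<Rightarrow> real"
  defines "d \<equiv> \<lambda>u. \<Sum>w\<in>UNIV. a u w"
  assumes sym: "\<And>u w. a u w = a w u" and nonneg: "\<And>u w. 0 \<le> a u w" and d: "\<And>u. 0 < d u"
    and s: "s = 1 \<or> s = -1" and c: "0 \<le> c" and r: "0 \<le> r" and g: "g z \<noteq> 0"
    and layer: "\<And>y. (\<And>v. y v = 0 \<or> y v = sgn (g v)) \<Longrightarrow>
      2 * c * (\<Sum>v\<in>UNIV. d v * \<bar>y v\<bar>) \<le> (\<Sum>u\<in>UNIV. \<Sum>w\<in>UNIV. a u w * \<bar>y u + s * y w\<bar>)"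
    and rayleigh: "r * (\<Sum>v\<in>UNIV. d v * (g v)\<^sup>2) \<le> (\<Sum>u\<in>UNIV. \<Sum>w\<in>UNIV. a u w * max 0 (- s * (g u * g w)))"
  shows "r\<^sup>2 \<le> 1 - c\<^sup>2"
proof -
  define \<phi> where "\<phi> v = g v * \<bar>g v\<bar>" for v
  define N where "N = (\<Sum>v\<in>UNIV. d v * \<bar>g v\<bar>\<^sup>2)"
  define Q where "Q = (\<Sum>u\<in>UNIV. \<Sum>w\<in>UNIV. if s * (g u * g w) \<le> 0 then a u w * (\<bar>g u\<bar> * \<bar>g w\<bar>) else 0)"
  define T where "T = (\<Sum>u\<in>UNIV. \<Sum>w\<in>UNIV. a u w *
    (if s * (g u * g w) \<le> 0 then \<bar>\<bar>g u\<bar>\<^sup>2 - \<bar>g w\<bar>\<^sup>2\<bar> else \<bar>g u\<bar>\<^sup>2 + \<bar>g w\<bar>\<^sup>2))"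
  have abs\<phi>: "\<bar>\<phi> v\<bar> = \<bar>g v\<bar>\<^sup>2" for v by (simp add: \<phi>_def abs_mult power2_eq_square)
  \<comment> \<open>The good pairs are those where \<open>\<phi> u\<close> and
    \<open>s * \<phi> w\<close> do not have the same strict sign: there the absolute values
    subtract, elsewhere they add.\<close>
  have abs2: "\<bar>\<phi> u + s * \<phi> w\<bar> = (if s * (g u * g w) \<le> 0 then \<bar>\<bar>g u\<bar>\<^sup>2 - \<bar>g w\<bar>\<^sup>2\<bar> else \<bar>g u\<bar>\<^sup>2 + \<bar>g w\<bar>\<^sup>2)" for u w
    using s
    by (cases "g u" "0::real" rule: linorder_cases; cases "g w" "0::real" rule: linorder_cases)
      (auto simp: \<phi>_def power2_eq_square mult_le_0_iff zero_le_mult_iff)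
  have "2 * c * (\<Sum>v\<in>UNIV. d v * \<bar>\<phi> v\<bar>) \<le> (\<Sum>u\<in>UNIV. \<Sum>w\<in>UNIV. a u w * \<bar>\<phi> u + s * \<phi> w\<bar>)"
  proof (rule layer_inequality[OF s])
    fix y assume "\<And>v. y v = 0 \<or> y v = sgn (\<phi> v)"
    moreover have "sgn (\<phi> v) = sgn (g v)" for v by (auto simp: \<phi>_def sgn_mult sgn_if)
    ultimately show "2 * c * (\<Sum>v\<in>UNIV. d v * \<bar>y v\<bar>) \<le> (\<Sum>u\<in>UNIV. \<Sum>w\<in>UNIV. a u w * \<bar>y u + s * y w\<bar>)"
      by (intro layer) simp
  qed
  then have "2 * c * N \<le> T" by (simp only: abs\<phi> abs2 N_def T_def)
  have N: "0 < N"
  proof -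
    have "0 < d z * \<bar>g z\<bar>\<^sup>2" using d[of z] g by simp
    also have "\<dots> \<le> N" unfolding N_def
      by (intro member_le_sum) (use d in \<open>auto intro: mult_nonneg_nonneg[OF less_imp_le]\<close>)
    finally show ?thesis .
  qed
  have "(\<Sum>u\<in>UNIV. \<Sum>w\<in>UNIV. a u w * max 0 (- s * (g u * g w))) = Q"
    unfolding Q_def
  proof (intro sum.cong refl)
    fix u w
    show "a u w * max 0 (- s * (g u * g w)) = (if s * (g u * g w) \<le> 0 then a u w * (\<bar>g u\<bar> * \<bar>g w\<bar>) else 0)"
      using s by (auto simp: abs_mult[symmetric])
  qed
  then have "r * N \<le> Q" using rayleigh by (simp add: N_def)
  have "(2 * c * N)\<^sup>2 \<le> T\<^sup>2" using \<open>2 * c * N \<le> T\<close> c N by (intro power_mono) auto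
  \<comment> \<open>Passing to absolute values treats both values of \<open>s\<close> alike: on good
    pairs \<open>\<bar>g u\<bar> * \<bar>g w\<bar>\<close> equals
    \<open>- s * (g u * g w)\<close>.\<close>
  also have "\<dots> \<le> 4 * (N\<^sup>2 - Q\<^sup>2)"
    using weighted_cut_Cauchy_Schwarz[OF sym nonneg, where good = "\<lambda>u w. s * (g u * g w) \<le> 0" and g = "\<lambda>v. \<bar>g v\<bar>"]
    unfolding N_def T_def Q_def d_def .
  finally have "(2 * c * N)\<^sup>2 \<le> 4 * (N\<^sup>2 - Q\<^sup>2)" .
  moreover have "(r * N)\<^sup>2 \<le> Q\<^sup>2" using \<open>r * N \<le> Q\<close> r N by (intro power_mono) auto
  ultimately have "4 * (N\<^sup>2 * c\<^sup>2) \<le> 4 * (N\<^sup>2 * (1 - r\<^sup>2))"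
    by (simp add: power_mult_distrib algebra_simps)
  then have "c\<^sup>2 \<le> 1 - r\<^sup>2" using N by simp
  then show ?thesis by simp
qed

section \<open>Degrees, volumes and the Cheeger constants\<close>

lemma adjacency_matrix_sym: "adjacency_matrix E $ u $ w = adjacency_matrix E $ w $ u"
  by (simp add: adjacency_matrix_def insert_commute)

lemma adjacency_matrix_nonneg: "0 \<le> adjacency_matrix E $ u $ w"
  by (simp add: adjacency_matrix_def)

lemma vertex_degree_eq_sum:
  assumes "simple_graph E"
  shows "real (vertex_degree E u) = (\<Sum>w\<in>UNIV. adjacency_matrix E $ u $ w)"
proof -
  have "bij_betw (\<lambda>w. {u, w}) {w. {u, w} \<in> E} {e \<in> E. u \<in> e}"
  proof (rule bij_betw_imageI)
    show "inj_on (\<lambda>w. {u, w}) {w. {u, w} \<in> E}" by (auto simp: inj_on_def doubleton_eq_iff)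
    have "e \<in> (\<lambda>w. {u, w}) ` {w. {u, w} \<in> E}" if e: "e \<in> E" "u \<in> e" for e
    proof -
      obtain x y where "e = {x, y}" using assms e(1) by (auto simp: simple_graph_def card_2_iff)
      then obtain w where "e = {u, w}" using e(2) by (metis doubleton_eq_iff insert_iff singletonD)
      then show ?thesis using e by auto
    qed
    then show "(\<lambda>w. {u, w}) ` {w. {u, w} \<in> E} = {e \<in> E. u \<in> e}" by auto
  qed
  then have "vertex_degree E u = card {w. {u, w} \<in> E}"
    unfolding vertex_degree_def by (rule bij_betw_same_card[symmetric])
  then show ?thesis by (simp add: adjacency_matrix_def flip: sum.inter_filter)
qed

text \<open>The handshake lemma: count incidences by vertex, then by edge.\<close>

lemma sum_vertex_degree:
  fixes E :: "'v::finite set set"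
  assumes "simple_graph E"
  shows "(\<Sum>v\<in>UNIV. vertex_degree E v) = 2 * card E"
proof -
  have "(\<Sum>v\<in>UNIV. vertex_degree E v) = (\<Sum>v\<in>UNIV. \<Sum>e\<in>E. if v \<in> e then 1 else 0)"
    by (simp add: vertex_degree_def flip: sum.inter_filter)
  also have "\<dots> = (\<Sum>e\<in>E. \<Sum>v\<in>UNIV. if v \<in> e then 1 else 0)" by (rule sum.swap)
  also have "\<dots> = (\<Sum>e\<in>E. card e)" by (simp add: flip: sum.inter_filter)
  also have "\<dots> = 2 * card E" using assms by (simp add: simple_graph_def)
  finally show ?thesis .
qed

lemma UNIV_neq_singleton:
  assumes "CARD('v::finite) \<ge> 2"
  shows "(UNIV :: 'v set) \<noteq> {u}"
proof
  assume "(UNIV :: 'v set) = {u}"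
  then have "CARD('v) = card {u}" by (rule arg_cong)
  then show False using assms by simp
qed

lemma vertex_degree_pos:
  fixes E :: "'v::finite set set"
  assumes "connected_graph E" "CARD('v) \<ge> 2"
  shows "0 < vertex_degree E u"
proof -
  obtain w where "w \<noteq> u"
    using UNIV_neq_singleton[OF assms(2), of u] by blast
  have "(u, w) \<in> {(x, y). {x, y} \<in> E}\<^sup>*" using assms(1) by (auto simp: connected_graph_def)
  then obtain x where "{u, x} \<in> E" using \<open>w \<noteq> u\<close> by (auto elim: converse_rtranclE)
  then have "{u, x} \<in> {e \<in> E. u \<in> e}" by simp
  then show ?thesis unfolding vertex_degree_def card_gt_0_iff by auto
qed

text \<open>Disjointness lets the ordered pair be recovered from its edge, so no edge is counted
  twice.\<close>

lemma card_edges_between: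
  assumes "U \<inter> W = {}"
  shows "real (card (edges_between E U W)) = (\<Sum>u\<in>U. \<Sum>w\<in>W. adjacency_matrix E $ u $ w)"
proof -
  define P where "P = {p \<in> U \<times> W. {fst p, snd p} \<in> E}"
  have "bij_betw (\<lambda>p. {fst p, snd p}) P (edges_between E U W)"
  proof (rule bij_betw_imageI)
    show "inj_on (\<lambda>p. {fst p, snd p}) P" using assms by (auto simp: P_def inj_on_def doubleton_eq_iff)
    have "{u, w} \<in> (\<lambda>p. {fst p, snd p}) ` P" if "{u, w} \<in> E" "u \<in> U" "w \<in> W" for u w
      by (rule image_eqI[of _ _ "(u, w)"]) (use that in \<open>simp_all add: P_def\<close>)
    then show "(\<lambda>p. {fst p, snd p}) ` P = edges_between E U W"
      by (auto simp: edges_between_def P_def) blast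
  qed
  then have "card (edges_between E U W) = card P" by (rule bij_betw_same_card[symmetric])
  also have "real (card P) = (\<Sum>p\<in>U \<times> W. adjacency_matrix E $ fst p $ snd p)"
    by (simp add: P_def adjacency_matrix_def flip: sum.inter_filter)
  also have "\<dots> = (\<Sum>u\<in>U. \<Sum>w\<in>W. adjacency_matrix E $ u $ w)"
    by (simp add: sum.cartesian_product split_beta)
  finally show ?thesis .
qed

section \<open>Bounds on the two Cheeger constants and their layer inequalities\<close>

lemma cheeger_le:
  assumes "U \<noteq> {}" "U \<noteq> UNIV"
  shows "cheeger E \<le> real (card (edges_between E U (- U))) / real (min (vol E U) (vol E (- U)))"
  unfolding cheeger_def using assms by (intro Min_le) auto

lemma cheeger_nonneg:
  fixes E :: "'v::finite set set"
  assumes "CARD('v) \<ge> 2"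
  shows "0 \<le> cheeger E"
proof -
  \<comment> \<open>With two vertices any singleton is a proper subset, so the minimum is over a
    nonempty set and is attained.\<close>
  have "{undefined :: 'v} \<noteq> UNIV" using UNIV_neq_singleton[OF assms] by (rule not_sym)
  then have "{real (card (edges_between E U (- U))) / real (min (vol E U) (vol E (- U))) |U.
     U \<noteq> {} \<and> U \<noteq> UNIV} \<noteq> {}" by blast
  then have "cheeger E \<in> {real (card (edges_between E U (- U))) / real (min (vol E U) (vol E (- U))) |U.
     U \<noteq> {} \<and> U \<noteq> UNIV}"
    unfolding cheeger_def by (intro Min_in) auto
  then show ?thesis by auto
qed

lemma finite_dual_cheeger_quotients:
  "finite {2 * real (card (edges_between E V\<^sub>1 V\<^sub>2)) / real (vol E V\<^sub>1 + vol E V\<^sub>2) |V\<^sub>1 V\<^sub>2.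
    V\<^sub>1 \<inter> V\<^sub>2 = {} \<and> \<not> (V\<^sub>1 = {} \<and> V\<^sub>2 = {})}" (is "finite ?R")
proof (rule finite_subset)
  let ?f = "\<lambda>(V\<^sub>1, V\<^sub>2). 2 * real (card (edges_between E V\<^sub>1 V\<^sub>2)) / real (vol E V\<^sub>1 + vol E V\<^sub>2)"
  show "?R \<subseteq> range ?f" by auto
qed simp

lemma dual_cheeger_ge:
  assumes "V\<^sub>1 \<inter> V\<^sub>2 = {}" "\<not> (V\<^sub>1 = {} \<and> V\<^sub>2 = {})"
  shows "2 * real (card (edges_between E V\<^sub>1 V\<^sub>2)) / real (vol E V\<^sub>1 + vol E V\<^sub>2) \<le> dual_cheeger E"
  unfolding dual_cheeger_def
  by (rule Max_ge[OF finite_dual_cheeger_quotients]) (use assms in blast)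

lemma real_vol_eq:
  assumes "simple_graph E"
  shows "real (vol E U) = (\<Sum>u\<in>U. \<Sum>w\<in>UNIV. adjacency_matrix E $ u $ w)"
  by (simp add: vol_def vertex_degree_eq_sum[OF assms])

text \<open>At a maximising pair, each crossing edge is counted once in the volume of either side.
  The bound makes \<open>1 - dual_cheeger E\<close> admissible as the constant \<open>c\<close>
  above.\<close>

lemma dual_cheeger_le_1:
  fixes E :: "'v::finite set set"
  assumes "simple_graph E"
  shows "dual_cheeger E \<le> 1"
proof -
  let ?f = "\<lambda>(V\<^sub>1, V\<^sub>2). 2 * real (card (edges_between E V\<^sub>1 V\<^sub>2)) / real (vol E V\<^sub>1 + vol E V\<^sub>2)"
  let ?R = "{2 * real (card (edges_between E V\<^sub>1 V\<^sub>2)) / real (vol E V\<^sub>1 + vol E V\<^sub>2) |V\<^sub>1 V\<^sub>2.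
       V\<^sub>1 \<inter> V\<^sub>2 = {} \<and> \<not> (V\<^sub>1 = {} \<and> V\<^sub>2 = {})}"
  have "?f (UNIV, {}) \<in> ?R" unfolding prod.case
    by (rule CollectI, rule exI[of _ UNIV], rule exI[of _ "{}"]) simp
  then have "?R \<noteq> {}" by blast
  with finite_dual_cheeger_quotients have "dual_cheeger E \<in> ?R"
    unfolding dual_cheeger_def by (rule Max_in)
  then obtain V\<^sub>1 V\<^sub>2 where V: "V\<^sub>1 \<inter> V\<^sub>2 = {}"
    and eq: "dual_cheeger E = 2 * real (card (edges_between E V\<^sub>1 V\<^sub>2)) / real (vol E V\<^sub>1 + vol E V\<^sub>2)" by blast
  have le: "real (card (edges_between E U W)) \<le> real (vol E U)" if "U \<inter> W = {}" for U W
    unfolding card_edges_between[OF that] real_vol_eq[OF assms]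
    by (intro sum_mono sum_mono2) (auto simp: adjacency_matrix_nonneg)
  have "edges_between E V\<^sub>1 V\<^sub>2 = edges_between E V\<^sub>2 V\<^sub>1" by (auto simp: edges_between_def)
  then have "2 * real (card (edges_between E V\<^sub>1 V\<^sub>2)) \<le> real (vol E V\<^sub>1 + vol E V\<^sub>2)"
    using le[OF V] le[of V\<^sub>2 V\<^sub>1] V by (simp add: Int_commute)
  \<comment> \<open>If both volumes vanish, the quotient is 0 by the convention
    \<open>x / 0 = 0\<close>.\<close>
  then show ?thesis unfolding eq by (simp add: divide_le_eq_1) linarith
qed

text \<open>For the indicator of \<open>U\<close> the left sum is the volume of \<open>U\<close>,
  and the right side counts each cut edge in both orders. By \<open>le\<close> the minimum in the
  Cheeger quotient is \<open>vol E U\<close>.\<close>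

lemma cheeger_layer:
  fixes E :: "'v::finite set set"
  assumes E: "simple_graph E" and deg: "\<And>v. 0 < vertex_degree E v"
    and y: "\<And>v. y v = 0 \<or> y v = (1::real)"
    and le: "vol E {v. y v = 1} \<le> vol E {v. y v = 0}"
  shows "2 * cheeger E * (\<Sum>v\<in>UNIV. (\<Sum>w\<in>UNIV. adjacency_matrix E $ v $ w) * \<bar>y v\<bar>)
    \<le> (\<Sum>u\<in>UNIV. \<Sum>w\<in>UNIV. adjacency_matrix E $ u $ w * \<bar>y u - y w\<bar>)"
proof -
  define U where "U = {v. y v = 1}"
  have yU: "y v = (if v \<in> U then 1 else 0)" for v using y[of v] by (auto simp: U_def)
  have "{v. y v = 0} = - U" using y by (force simp: U_def)
  then have le: "vol E U \<le> vol E (- U)" using le by (simp add: U_def)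
  have vol: "(\<Sum>v\<in>UNIV. (\<Sum>w\<in>UNIV. adjacency_matrix E $ v $ w) * \<bar>y v\<bar>) = real (vol E U)"
    unfolding real_vol_eq[OF E] yU by (simp add: if_distrib sum.If_cases)
  have "(\<Sum>u\<in>UNIV. \<Sum>w\<in>UNIV. adjacency_matrix E $ u $ w * \<bar>y u - y w\<bar>) =
    (\<Sum>u\<in>UNIV. \<Sum>w\<in>UNIV. (if u \<in> U then if w \<in> - U then adjacency_matrix E $ u $ w else 0 else 0)
      + (if w \<in> U then if u \<in> - U then adjacency_matrix E $ w $ u else 0 else 0))"
    by (intro sum.cong refl) (auto simp: yU adjacency_matrix_sym)
  also have "\<dots> = 2 * (\<Sum>u\<in>UNIV. \<Sum>w\<in>UNIV. if u \<in> U then if w \<in> - U then adjacency_matrix E $ u $ w else 0 else 0)"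
    unfolding sum.distrib by (subst (2) sum.swap) simp
  also have "(\<Sum>u\<in>UNIV. \<Sum>w\<in>UNIV. if u \<in> U then if w \<in> - U then adjacency_matrix E $ u $ w else 0 else 0) =
     (\<Sum>u\<in>UNIV. if u \<in> U then \<Sum>w\<in>UNIV. if w \<in> - U then adjacency_matrix E $ u $ w else 0 else 0)"
    by (intro sum.cong refl) simp
  also have "\<dots> = (\<Sum>u\<in>U. \<Sum>w\<in>-U. adjacency_matrix E $ u $ w)"
    by (simp add: sum.If_cases Compl_eq)
  also have "\<dots> = real (card (edges_between E U (- U)))" by (subst card_edges_between) auto
  finally have cut: "(\<Sum>u\<in>UNIV. \<Sum>w\<in>UNIV. adjacency_matrix E $ u $ w * \<bar>y u - y w\<bar>) =
    2 * real (card (edges_between E U (- U)))" .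
  have "cheeger E * real (vol E U) \<le> real (card (edges_between E U (- U)))"
  proof (cases "U = {}")
    case True
    then show ?thesis by (simp add: vol_def)
  next
    case False
    then have pos: "0 < vol E U" unfolding vol_def by (intro sum_pos) (auto simp: deg)
    \<comment> \<open>By \<open>le\<close> the complement of \<open>U\<close> also has positive
      volume.\<close>
    have "U \<noteq> UNIV" using pos le by (auto simp: vol_def)
    from cheeger_le[OF False this, of E] show ?thesis
      using pos le by (simp add: min_def pos_le_divide_eq)
  qed
  then show ?thesis unfolding vol cut by simp
qed

text \<open>\<open>\<bar>y u + y w\<bar>\<close> falls short of
  \<open>\<bar>y u\<bar> + \<bar>y w\<bar>\<close> by 2 exactly when the pair joins the two sign
  classes. Hence the right side is twice the total volume minus four times the number of crossing
  edges.\<close>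

lemma dual_cheeger_layer:
  fixes E :: "'v::finite set set"
  assumes E: "simple_graph E" and deg: "\<And>v. 0 < vertex_degree E v"
    and y: "\<And>v. y v = 0 \<or> y v = (1::real) \<or> y v = - 1"
  shows "2 * (1 - dual_cheeger E) * (\<Sum>v\<in>UNIV. (\<Sum>w\<in>UNIV. adjacency_matrix E $ v $ w) * \<bar>y v\<bar>)
    \<le> (\<Sum>u\<in>UNIV. \<Sum>w\<in>UNIV. adjacency_matrix E $ u $ w * \<bar>y u + y w\<bar>)"
proof -
  define V\<^sub>1 V\<^sub>2 where "V\<^sub>1 = {v. y v = 1}" and "V\<^sub>2 = {v. y v = -1}"
  let ?a = "\<lambda>u w. adjacency_matrix E $ u $ w"
  let ?cut = "\<lambda>u w. if u \<in> V\<^sub>1 then if w \<in> V\<^sub>2 then ?a u w else 0 else 0"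
  have disj: "V\<^sub>1 \<inter> V\<^sub>2 = {}" by (auto simp: V\<^sub>1_def V\<^sub>2_def)
  have absy: "\<bar>y v\<bar> = (if v \<in> V\<^sub>1 \<union> V\<^sub>2 then 1 else 0)" for v using y[of v] by (auto simp: V\<^sub>1_def V\<^sub>2_def)
  have "(\<Sum>v\<in>UNIV. (\<Sum>w\<in>UNIV. ?a v w) * \<bar>y v\<bar>) = (\<Sum>v\<in>V\<^sub>1 \<union> V\<^sub>2. \<Sum>w\<in>UNIV. ?a v w)"
    unfolding absy by (simp add: if_distrib sum.If_cases Collect_disj_eq)
  also have "\<dots> = real (vol E V\<^sub>1 + vol E V\<^sub>2)"
    by (simp add: real_vol_eq[OF E] sum.union_disjoint disj)
  finally have vol: "(\<Sum>v\<in>UNIV. (\<Sum>w\<in>UNIV. ?a v w) * \<bar>y v\<bar>) = real (vol E V\<^sub>1 + vol E V\<^sub>2)" .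
  have vol1: "(\<Sum>u\<in>UNIV. \<Sum>w\<in>UNIV. ?a u w * \<bar>y u\<bar>) = real (vol E V\<^sub>1 + vol E V\<^sub>2)"
    unfolding vol[symmetric] by (simp add: sum_distrib_right)
  have vol2: "(\<Sum>u\<in>UNIV. \<Sum>w\<in>UNIV. ?a u w * \<bar>y w\<bar>) = real (vol E V\<^sub>1 + vol E V\<^sub>2)"
    unfolding vol1[symmetric] by (subst sum.swap) (simp add: adjacency_matrix_sym)
  have "(\<Sum>u\<in>UNIV. \<Sum>w\<in>UNIV. ?cut u w) =
     (\<Sum>u\<in>UNIV. if u \<in> V\<^sub>1 then \<Sum>w\<in>UNIV. if w \<in> V\<^sub>2 then ?a u w else 0 else 0)"
    by (intro sum.cong refl) simp
  also have "\<dots> = real (card (edges_between E V\<^sub>1 V\<^sub>2))"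
    unfolding card_edges_between[OF disj] by (simp add: sum.If_cases)
  finally have cut: "(\<Sum>u\<in>UNIV. \<Sum>w\<in>UNIV. ?cut u w) = real (card (edges_between E V\<^sub>1 V\<^sub>2))" .
  have cut': "(\<Sum>u\<in>UNIV. \<Sum>w\<in>UNIV. ?cut w u) = real (card (edges_between E V\<^sub>1 V\<^sub>2))"
    unfolding cut[symmetric] by (rule sum.swap)
  have "?a u w * \<bar>y u + y w\<bar> = ?a u w * \<bar>y u\<bar> + ?a u w * \<bar>y w\<bar> - 2 * ?cut u w - 2 * ?cut w u" for u w
    using y[of u] y[of w] adjacency_matrix_sym[of E u w] by (auto simp: V\<^sub>1_def V\<^sub>2_def)
  then have sum: "(\<Sum>u\<in>UNIV. \<Sum>w\<in>UNIV. ?a u w * \<bar>y u + y w\<bar>) =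
    2 * real (vol E V\<^sub>1 + vol E V\<^sub>2) - 4 * real (card (edges_between E V\<^sub>1 V\<^sub>2))"
    by (simp only: sum.distrib sum_subtractf sum_distrib_left[symmetric] vol1 vol2 cut cut') simp
  have "2 * real (card (edges_between E V\<^sub>1 V\<^sub>2)) \<le> dual_cheeger E * real (vol E V\<^sub>1 + vol E V\<^sub>2)"
  proof (cases "V\<^sub>1 = {} \<and> V\<^sub>2 = {}")
    case True
    then show ?thesis by (simp add: vol_def edges_between_def)
  next
    case False
    have "0 < (\<Sum>v\<in>V\<^sub>1 \<union> V\<^sub>2. vertex_degree E v)" using False by (intro sum_pos) (auto simp: deg)
    then have "0 < vol E V\<^sub>1 + vol E V\<^sub>2" by (simp add: vol_def sum.union_disjoint disj)
    then have "0 < real (vol E V\<^sub>1 + vol E V\<^sub>2)" by (simp only: of_nat_0_less_iff)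
    then show ?thesis using dual_cheeger_ge[OF disj False, of E] by (simp only: pos_divide_le_eq)
  qed
  then show ?thesis unfolding vol sum by (simp add: algebra_simps)
qed

section \<open>Eigenvalue bounds\<close>

text \<open>Layers of the positive part of \<open>f\<close> lie in \<open>{v. 0 < f v}\<close>, and
  \<open>half\<close> makes their volume at most that of the complement, as
  \<open>cheeger_layer\<close> requires.\<close>

lemma cheeger_eigenvalue_half:
  fixes E :: "'v::finite set set"
  assumes E: "simple_graph E" "connected_graph E" "CARD('v) \<ge> 2"
    and eig: "\<And>v. (\<Sum>w\<in>UNIV. adjacency_matrix E $ v $ w * f w) = l * real (vertex_degree E v) * f v"
    and l: "0 \<le> l" and z: "0 < f z" and half: "vol E {v. 0 < f v} \<le> vol E {v. f v < 0}"
  shows "l\<^sup>2 \<le> 1 - (cheeger E)\<^sup>2"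
proof -
  note deg = vertex_degree_pos[OF E(2,3)]
  \<comment> \<open>The positive part of \<open>f\<close> satisfies only the eigenvalue inequality, which is the useful direction.\<close>
  define g where "g v = max 0 (f v)" for v
  show ?thesis
  proof (rule weighted_cheeger_inequality[where a = "\<lambda>u w. adjacency_matrix E $ u $ w" and s = "-1" and g = g])
    show "0 < (\<Sum>w\<in>UNIV. adjacency_matrix E $ u $ w)" for u
      using deg[of u] by (simp flip: vertex_degree_eq_sum[OF E(1)])
    show "g z \<noteq> 0" using z by (simp add: g_def)
    show "2 * cheeger E * (\<Sum>v\<in>UNIV. (\<Sum>w\<in>UNIV. adjacency_matrix E $ v $ w) * \<bar>y v\<bar>)
      \<le> (\<Sum>u\<in>UNIV. \<Sum>w\<in>UNIV. adjacency_matrix E $ u $ w * \<bar>y u + - 1 * y w\<bar>)"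
      if y: "\<And>v. y v = 0 \<or> y v = sgn (g v)" for y
    proof -
      have sub: "{v. y v = 1} \<subseteq> {v. 0 < f v}" "{v. f v < 0} \<subseteq> {v. y v = 0}"
      proof safe
        fix v
        show "0 < f v" if "y v = 1" using y[of v] that by (auto simp: g_def max_def sgn_if split: if_splits)
        show "y v = 0" if "f v < 0" using y[of v] that by (auto simp: g_def max_def split: if_splits)
      qed
      have "vol E {v. y v = 1} \<le> vol E {v. 0 < f v}" "vol E {v. f v < 0} \<le> vol E {v. y v = 0}"
        unfolding vol_def by (intro sum_mono2 sub; simp)+
      then have "vol E {v. y v = 1} \<le> vol E {v. y v = 0}" using half by linarith
      moreover have "y v = 0 \<or> y v = 1" for v using y[of v] by (auto simp: g_def sgn_if max_def split: if_splits)
      ultimately have "2 * cheeger E * (\<Sum>v\<in>UNIV. (\<Sum>w\<in>UNIV. adjacency_matrix E $ v $ w) * \<bar>y v\<bar>)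
        \<le> (\<Sum>u\<in>UNIV. \<Sum>w\<in>UNIV. adjacency_matrix E $ u $ w * \<bar>y u - y w\<bar>)"
        by (intro cheeger_layer[OF E(1) deg])
      then show ?thesis by simp
    qed
    \<comment> \<open>Since \<open>g v * g v = g v * f v\<close>, the eigenvalue equation for
      \<open>f\<close> can be inserted.\<close>
    have "l * (\<Sum>v\<in>UNIV. (\<Sum>w\<in>UNIV. adjacency_matrix E $ v $ w) * (g v)\<^sup>2) =
      (\<Sum>v\<in>UNIV. g v * (l * real (vertex_degree E v) * f v))"
      unfolding sum_distrib_left vertex_degree_eq_sum[OF E(1), symmetric]
      by (intro sum.cong refl) (auto simp: g_def max_def power2_eq_square)
    also have "\<dots> = (\<Sum>u\<in>UNIV. \<Sum>w\<in>UNIV. adjacency_matrix E $ u $ w * (g u * f w))"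
      unfolding eig[symmetric] by (simp add: sum_distrib_left ac_simps)
    also have "\<dots> \<le> (\<Sum>u\<in>UNIV. \<Sum>w\<in>UNIV. adjacency_matrix E $ u $ w * max 0 (- (-1) * (g u * g w)))"
    proof (intro sum_mono mult_left_mono adjacency_matrix_nonneg)
      fix u w
      have "g u * f w \<le> g u * g w" by (intro mult_left_mono) (simp_all add: g_def)
      then show "g u * f w \<le> max 0 (- (-1) * (g u * g w))" by simp
    qed
    finally show "l * (\<Sum>v\<in>UNIV. (\<Sum>w\<in>UNIV. adjacency_matrix E $ v $ w) * (g v)\<^sup>2)
      \<le> (\<Sum>u\<in>UNIV. \<Sum>w\<in>UNIV. adjacency_matrix E $ u $ w * max 0 (- (-1) * (g u * g w)))" .
  qed (use l cheeger_nonneg[OF E(3), of E] in \<open>simp_all add: adjacency_matrix_nonneg adjacency_matrix_sym\<close>)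
qed

text \<open>Degree-weighted mean zero forces \<open>f\<close> to take both signs. Both
  \<open>f\<close> and \<open>- f\<close> solve the eigenvalue equation, and the one that is
  positive on the smaller volume fits the previous lemma.\<close>

lemma cheeger_eigenvalue:
  fixes E :: "'v::finite set set"
  assumes E: "simple_graph E" "connected_graph E" "CARD('v) \<ge> 2"
    and eig: "\<And>v. (\<Sum>w\<in>UNIV. adjacency_matrix E $ v $ w * f w) = l * real (vertex_degree E v) * f v"
    and l: "0 \<le> l" and z: "f z \<noteq> 0" and orth: "(\<Sum>v\<in>UNIV. real (vertex_degree E v) * f v) = 0"
  shows "l\<^sup>2 \<le> 1 - (cheeger E)\<^sup>2"
proof -
  note deg = vertex_degree_pos[OF E(2,3)]
  have pos: "\<exists>x. 0 < h x" if "h z \<noteq> 0" "(\<Sum>v\<in>UNIV. real (vertex_degree E v) * h v) = 0" for h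
  proof (rule ccontr)
    assume "\<not> ?thesis"
    then have le: "h x \<le> 0" for x by (simp add: not_less)
    have "h z < 0" using le[of z] that(1) by simp
    then have "real (vertex_degree E z) * h z < 0" using deg[of z] by (simp add: mult_pos_neg)
    then have "(\<Sum>v\<in>UNIV. real (vertex_degree E v) * h v) < (\<Sum>v\<in>(UNIV :: 'v set). 0)"
      by (intro sum_strict_mono_ex1) (auto intro: mult_nonneg_nonpos le)
    then show False using that(2) by simp
  qed
  show ?thesis
  proof (cases "vol E {v. 0 < f v} \<le> vol E {v. f v < 0}")
    case True
    obtain x where "0 < f x" using pos[OF z orth] by blast
    then show ?thesis by (rule cheeger_eigenvalue_half[OF E eig l _ True])
  next
    case False
    obtain x where "0 < - f x" using pos[of "\<lambda>v. - f v"] z orth by (auto simp: sum_negf)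
    moreover have "(\<Sum>w\<in>UNIV. adjacency_matrix E $ v $ w * - f w) = l * real (vertex_degree E v) * - f v" for v
      using eig[of v] by (simp add: sum_negf)
    ultimately show ?thesis using False
      by (intro cheeger_eigenvalue_half[OF E, where f = "\<lambda>v. - f v" and l = l and z = x] l) simp_all
  qed
qed

text \<open>Here \<open>f\<close> enters whole, its layers having both signs. Pairs of equal sign
  contribute negatively to the sum of \<open>- (f u * f w)\<close>, so cutting them off with
  \<open>max 0\<close> only increases it.\<close>

lemma dual_cheeger_eigenvalue:
  fixes E :: "'v::finite set set"
  assumes E: "simple_graph E" "connected_graph E" "CARD('v) \<ge> 2"
    and eig: "\<And>v. (\<Sum>w\<in>UNIV. adjacency_matrix E $ v $ w * f w) = l * real (vertex_degree E v) * f v"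
    and l: "l \<le> 0" and z: "f z \<noteq> 0"
  shows "l\<^sup>2 \<le> 1 - (1 - dual_cheeger E)\<^sup>2"
proof -
  note deg = vertex_degree_pos[OF E(2,3)]
  have "(- l)\<^sup>2 \<le> 1 - (1 - dual_cheeger E)\<^sup>2"
  proof (rule weighted_cheeger_inequality[where a = "\<lambda>u w. adjacency_matrix E $ u $ w" and s = 1 and g = f])
    show "0 < (\<Sum>w\<in>UNIV. adjacency_matrix E $ u $ w)" for u
      using deg[of u] by (simp flip: vertex_degree_eq_sum[OF E(1)])
    show "2 * (1 - dual_cheeger E) * (\<Sum>v\<in>UNIV. (\<Sum>w\<in>UNIV. adjacency_matrix E $ v $ w) * \<bar>y v\<bar>)
      \<le> (\<Sum>u\<in>UNIV. \<Sum>w\<in>UNIV. adjacency_matrix E $ u $ w * \<bar>y u + 1 * y w\<bar>)"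
      if y: "\<And>v. y v = 0 \<or> y v = sgn (f v)" for y
    proof -
      have "y v = 0 \<or> y v = 1 \<or> y v = - 1" for v using y[of v] by (auto simp: sgn_if split: if_splits)
      from dual_cheeger_layer[OF E(1) deg this] show ?thesis by simp
    qed
    have "- l * (\<Sum>v\<in>UNIV. (\<Sum>w\<in>UNIV. adjacency_matrix E $ v $ w) * (f v)\<^sup>2) =
      (\<Sum>v\<in>UNIV. - f v * (l * real (vertex_degree E v) * f v))"
      unfolding sum_distrib_left vertex_degree_eq_sum[OF E(1), symmetric]
      by (intro sum.cong refl) (simp add: power2_eq_square)
    also have "\<dots> = (\<Sum>u\<in>UNIV. \<Sum>w\<in>UNIV. adjacency_matrix E $ u $ w * (- (f u * f w)))"
      unfolding eig[symmetric] by (simp add: sum_distrib_left ac_simps)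
    also have "\<dots> \<le> (\<Sum>u\<in>UNIV. \<Sum>w\<in>UNIV. adjacency_matrix E $ u $ w * max 0 (- 1 * (f u * f w)))"
      by (intro sum_mono mult_left_mono adjacency_matrix_nonneg) simp
    finally show "- l * (\<Sum>v\<in>UNIV. (\<Sum>w\<in>UNIV. adjacency_matrix E $ v $ w) * (f v)\<^sup>2)
      \<le> (\<Sum>u\<in>UNIV. \<Sum>w\<in>UNIV. adjacency_matrix E $ u $ w * max 0 (- 1 * (f u * f w)))" .
  qed (use l z dual_cheeger_le_1[OF E(1)] in \<open>simp_all add: adjacency_matrix_nonneg adjacency_matrix_sym\<close>)
  then show ?thesis by simp
qed

section \<open>Entries of the normalized Laplacian and the energy bound\<close>

lemma normalized_laplacian_minus_1:
  "(normalized_laplacian E - mat 1) $ u $ w =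
    - (adjacency_matrix E $ u $ w / (sqrt (real (vertex_degree E u)) * sqrt (real (vertex_degree E w))))"
proof -
  define D where "D = (\<lambda>v. real (vertex_degree E v) powr (- 1 / 2))"
  \<comment> \<open>This includes degree 0, where both sides are 0.\<close>
  have D: "D v = 1 / sqrt (real (vertex_degree E v))" for v
    by (simp add: D_def powr_minus_divide powr_half_sqrt)
  have L: "(degree_matrix_inv_sqrt E ** adjacency_matrix E) $ u $ j = D u * adjacency_matrix E $ u $ j" for j
    unfolding matrix_matrix_mult_def degree_matrix_inv_sqrt_def D_def
    by (simp add: if_distrib[of "\<lambda>x. x * _"] cong: if_cong)
  have "(degree_matrix_inv_sqrt E ** adjacency_matrix E ** degree_matrix_inv_sqrt E) $ u $ w
    = (\<Sum>j\<in>UNIV. D u * adjacency_matrix E $ u $ j * (degree_matrix_inv_sqrt E $ j $ w))"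
    by (simp add: matrix_matrix_mult_def[of "degree_matrix_inv_sqrt E ** adjacency_matrix E"] L)
  also have "\<dots> = D u * adjacency_matrix E $ u $ w * D w"
    unfolding degree_matrix_inv_sqrt_def D_def by (simp add: if_distrib[of "\<lambda>x. _ * x"] cong: if_cong)
  also have "\<dots> = adjacency_matrix E $ u $ w / (sqrt (real (vertex_degree E u)) * sqrt (real (vertex_degree E w)))"
    by (simp add: D)
  finally show ?thesis unfolding normalized_laplacian_def by simp
qed

theorem theorem4p9:
  fixes E :: "'v::finite set set" and v :: 'v and m :: nat and \<alpha> :: real
  assumes "simple_graph E"
    and "connected_graph E"
    and "CARD('v) \<ge> 2"
  defines "m \<equiv> card E"
    and "\<alpha> \<equiv> max (sqrt (1 - (cheeger E)\<^sup>2)) (sqrt (1 - (1 - dual_cheeger E)\<^sup>2))"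
  shows "laplacian_vertex_energy E v
           \<le> real (vertex_degree E v) / (2 * real m) + \<alpha> * (1 - real (vertex_degree E v) / (2 * real m))"
proof -
  note E = assms(1-3)
  define B where "B = normalized_laplacian E - mat 1"
  define d where "d v = real (vertex_degree E v)" for v
  let ?a = "\<lambda>u w. adjacency_matrix E $ u $ w"
  have d: "0 < d v" for v using vertex_degree_pos[OF E(2,3), of v] by (simp add: d_def)
  have d_sum: "d v = (\<Sum>w\<in>UNIV. ?a v w)" for v by (simp add: d_def vertex_degree_eq_sum[OF E(1)])
  have sum_d: "(\<Sum>v\<in>UNIV. d v) = 2 * real m"
    using arg_cong[OF sum_vertex_degree[OF E(1)], of real] by (simp add: d_def m_def)
  have "0 < (\<Sum>v\<in>UNIV. d v)" by (intro sum_pos) (simp_all add: d)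
  then have m: "0 < real m" using sum_d by simp
  have B: "B $ u $ w = - (?a u w / (sqrt (d u) * sqrt (d w)))" for u w
    by (simp only: B_def normalized_laplacian_minus_1 d_def)
  have Bv: "(B *v y) $ u = - ((\<Sum>w\<in>UNIV. ?a u w * (y $ w / sqrt (d w))) / sqrt (d u))" for y u
    by (simp add: matrix_vector_mult_def B sum_negf sum_divide_distrib ac_simps)
  have "transpose B = B" by (simp add: transpose_def vec_eq_iff B adjacency_matrix_sym mult.commute)
  \<comment> \<open>D^(1/2) applied to the all-ones vector, normalised by the handshake lemma; by
    \<open>xd\<close> the entries of \<open>B *v x\<close> reduce to row sums of the adjacency
    matrix, that is, to degrees.\<close>
  define x where "x = (\<chi> v. sqrt (d v / (2 * real m)))"
  have xd: "x $ w / sqrt (d w) = 1 / sqrt (2 * real m)" for w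
    using d[of w] by (simp add: x_def real_sqrt_divide)
  have "B *v x = (- 1) *\<^sub>R x"
  proof -
    have "(B *v x) $ u = - x $ u" for u
    proof -
      have "(B *v x) $ u = - (d u * (1 / sqrt (2 * real m)) / sqrt (d u))"
        unfolding Bv xd by (simp only: sum_distrib_right[symmetric] d_sum[symmetric])
      also have "\<dots> = - ((d u / sqrt (d u)) / sqrt (2 * real m))" by simp
      also have "d u / sqrt (d u) = sqrt (d u)" using d[of u] by (intro real_div_sqrt) simp
      finally show ?thesis by (simp add: x_def real_sqrt_divide)
    qed
    then show ?thesis by (simp add: vec_eq_iff)
  qed
  moreover have "norm x = 1"
  proof -
    have "x \<bullet> x = (\<Sum>v\<in>UNIV. d v / (2 * real m))"
      unfolding inner_vec_def using d m by (intro sum.cong refl) (simp add: x_def less_imp_le)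
    also have "\<dots> = 1" using m by (simp add: sum_d flip: sum_divide_distrib)
    finally show ?thesis by (simp add: norm_eq_sqrt_inner)
  qed
  moreover have "\<bar>r\<bar> \<le> \<alpha>" if y: "y \<noteq> 0" "x \<bullet> y = 0" "B *v y = r *\<^sub>R y" for r y
  proof -
    \<comment> \<open>The substitution y = D^(1/2) f turns \<open>B *v y = r *\<^sub>R y\<close>
      into A f = - r D f, and orthogonality to \<open>x\<close> into degree-weighted mean
      zero.\<close>
    define f where "f v = y $ v / sqrt (d v)" for v
    have yf: "y $ v = sqrt (d v) * f v" for v using d[of v] by (simp add: f_def)
    obtain z where "y $ z \<noteq> 0" using y(1) by (auto simp: vec_eq_iff)
    then have z: "f z \<noteq> 0" by (simp add: yf)
    have "(\<Sum>w\<in>UNIV. ?a v w * f w) = - r * real (vertex_degree E v) * f v" for v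
    proof -
      have "- ((\<Sum>w\<in>UNIV. ?a v w * f w) / sqrt (d v)) = r * (sqrt (d v) * f v)"
        using arg_cong[OF y(3), of "\<lambda>x. x $ v"] unfolding Bv f_def[symmetric] by (simp add: yf)
      then have "(\<Sum>w\<in>UNIV. ?a v w * f w) = - (r * (sqrt (d v) * f v)) * sqrt (d v)"
        using d[of v] by (simp add: field_simps)
      also have "\<dots> = - r * (sqrt (d v) * sqrt (d v)) * f v" by (simp only: mult_minus_left mult_minus_right ac_simps)
      finally show ?thesis using d[of v] by (simp add: d_def)
    qed
    note eig = this
    have "x \<bullet> y = (\<Sum>v\<in>UNIV. d v * f v / sqrt (2 * real m))"
      unfolding inner_vec_def
    proof (intro sum.cong refl)
      fix v
      have "x $ v \<bullet> y $ v = (sqrt (d v) * sqrt (d v)) * f v / sqrt (2 * real m)"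
        by (simp add: x_def yf real_sqrt_divide)
      then show "x $ v \<bullet> y $ v = d v * f v / sqrt (2 * real m)" using d[of v] by simp
    qed
    then have orth: "(\<Sum>v\<in>UNIV. real (vertex_degree E v) * f v) = 0"
      using y(2) m by (simp add: d_def flip: sum_divide_distrib)
    \<comment> \<open>The eigenvalue \<open>r\<close> of \<open>B\<close> appears as
      \<open>- r\<close> for \<open>f\<close>, so \<open>r \<le> 0\<close> falls under the Cheeger
      bound and \<open>r > 0\<close> under the dual one.\<close>
    show ?thesis
    proof (cases "r \<le> 0")
      case True
      then have "(- r)\<^sup>2 \<le> 1 - (cheeger E)\<^sup>2"
        by (intro cheeger_eigenvalue[OF E eig _ z orth]) simp
      then show ?thesis unfolding \<alpha>_def using real_le_rsqrt[of "- r"] True by (simp add: le_max_iff_disj)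
    next
      case False
      then have "(- r)\<^sup>2 \<le> 1 - (1 - dual_cheeger E)\<^sup>2"
        by (intro dual_cheeger_eigenvalue[OF E eig _ z]) simp
      then show ?thesis unfolding \<alpha>_def using real_le_rsqrt[of r] False by (simp add: le_max_iff_disj)
    qed
  qed
  ultimately have "matrix_abs B $ v $ v \<le> \<bar>- 1\<bar> * (x $ v)\<^sup>2 + \<alpha> * (1 - (x $ v)\<^sup>2)"
    by (rule matrix_abs_diag_le[OF \<open>transpose B = B\<close>])
  moreover have "(x $ v)\<^sup>2 = d v / (2 * real m)" using d[of v] m by (simp add: x_def)
  ultimately show ?thesis by (simp add: laplacian_vertex_energy_def B_def d_def)
qed

end
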